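(* For every integer $k\ge 3$ there are a prime graph $G_k$ with $\deg(G_k)=k$ and a 2-switch $\tau$ on $G_k$ with $\deg(\tau(G_k))=2k-2$; in particular, the realization graph $\mathcal{G}(G_k)$ is not regular.
   Context: Graphs are finite and simple, with nonempty vertex set. A 2-switch $\tau$ on $G$: given four distinct vertices $a,b,x,y$ with $ab,xy\in E(G)$ and $ax,by\notin E(G)$, delete the edges $ab,xy$ and add the edges $ax,by$; the resulting graph is $\tau(G)$ (two 2-switches are equal iff they delete the same two edges and add the same two edges). The 2-switch-degree $\deg(G)$ is the number of distinct 2-switches that can be performed on $G$. A vertex is active in $G$ if it is one of the four vertices involved in some 2-switch on $G$; $G$ is active if all its vertices are active. A split graph is a graph whose vertex set can be partitioned into a clique $K$ and an independent set $I$ (either possibly empty); when such a bipartition is fixed one writes $(S,K,I)$. If $(S,K,I)$ is split and $G$ is a graph vertex-disjoint from $S$, the Tyshkevich composition $(S,K,I)\circ G$ has vertex set $V(S)\cup V(G)$ and edge set $E(S)\cup E(G)\cup\{xy: x\in K,\ y\in V(G)\}$. A graph $G$ is decomposable if $G=S\circ H$ for some $S,H$ with $|S|,|H|\ge1$, and indecomposable otherwise. A graph is prime if it is indecomposable and active. For a graph $X$, the realization graph $\mathcal{G}(X)$ has as vertices all labeled graphs on the vertex set $V(X)$ in which every $v\in V(X)$ has the same degree as in $X$, two of them being adjacent iff one is obtained from the other by a single 2-switch. *)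

theory Defs
  imports Main
begin

record 'a sgraph =
  verts :: "'a set"
  edges :: "'a set set"

definition simple_graph :: "'a sgraph \<Rightarrow> bool" where
  "simple_graph G \<longleftrightarrow>
     finite (verts G) \<and> verts G \<noteq> {} \<and> (\<forall>e\<in>edges G. e \<subseteq> verts G \<and> card e = 2)"

definition degree :: "'a sgraph \<Rightarrow> 'a \<Rightarrow> nat" where
  "degree G v = card {e \<in> edges G. v \<in> e}"

definition regular :: "'a sgraph \<Rightarrow> bool" where
  "regular G \<longleftrightarrow> (\<exists>d. \<forall>v\<in>verts G. degree G v = d)"

(* A 2-switch is the pair (deleted edges, added edges).  Equality of such pairs is exactly
   the identification of 2-switches, so different quadruples (a, b, x, y) giving the same
   deletions and additions are counted once. *)
type_synonym 'a switch = "'a set set \<times> 'a set set"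

definition switches :: "'a sgraph \<Rightarrow> 'a switch set" where
  "switches G =
     {({{a, b}, {x, y}}, {{a, x}, {b, y}}) | a b x y.
        a \<in> verts G \<and> b \<in> verts G \<and> x \<in> verts G \<and> y \<in> verts G \<and> distinct [a, b, x, y] \<and>
        {a, b} \<in> edges G \<and> {x, y} \<in> edges G \<and> {a, x} \<notin> edges G \<and> {b, y} \<notin> edges G}"

definition apply_switch :: "'a switch \<Rightarrow> 'a sgraph \<Rightarrow> 'a sgraph" where
  "apply_switch \<tau> G = \<lparr>verts = verts G, edges = (edges G - fst \<tau>) \<union> snd \<tau>\<rparr>"

definition switch_deg :: "'a sgraph \<Rightarrow> nat" where
  "switch_deg G = card (switches G)"

definition active_vertex :: "'a sgraph \<Rightarrow> 'a \<Rightarrow> bool" where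
  "active_vertex G v \<longleftrightarrow> (\<exists>\<tau>\<in>switches G. v \<in> \<Union> (fst \<tau> \<union> snd \<tau>))"

definition active :: "'a sgraph \<Rightarrow> bool" where
  "active G \<longleftrightarrow> (\<forall>v\<in>verts G. active_vertex G v)"

definition split_graph :: "'a sgraph \<Rightarrow> 'a set \<Rightarrow> 'a set \<Rightarrow> bool" where
  "split_graph S K I \<longleftrightarrow>
     simple_graph S \<and> verts S = K \<union> I \<and> K \<inter> I = {} \<and>
     (\<forall>x\<in>K. \<forall>y\<in>K. x \<noteq> y \<longrightarrow> {x, y} \<in> edges S) \<and>
     (\<forall>x\<in>I. \<forall>y\<in>I. {x, y} \<notin> edges S)"

(* The composition (S, K, I) o H; the independent part I is determined by S and K. *)
definition tyshkevich_comp :: "'a sgraph \<Rightarrow> 'a set \<Rightarrow> 'a sgraph \<Rightarrow> 'a sgraph" where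
  "tyshkevich_comp S K H =
     \<lparr>verts = verts S \<union> verts H,
      edges = edges S \<union> edges H \<union> {{x, y} | x y. x \<in> K \<and> y \<in> verts H}\<rparr>"

(* |S|, |H| >= 1 holds because a simple graph has a nonempty vertex set. *)
definition decomposable :: "'a sgraph \<Rightarrow> bool" where
  "decomposable G \<longleftrightarrow>
     (\<exists>S K I H. split_graph S K I \<and> simple_graph H \<and> verts S \<inter> verts H = {} \<and>
        G = tyshkevich_comp S K H)"

definition prime_graph :: "'a sgraph \<Rightarrow> bool" where
  "prime_graph G \<longleftrightarrow> simple_graph G \<and> \<not> decomposable G \<and> active G"

definition realizations :: "'a sgraph \<Rightarrow> 'a sgraph set" where
  "realizations X =
     {G. simple_graph G \<and> verts G = verts X \<and> (\<forall>v\<in>verts X. degree G v = degree X v)}"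

definition realization_graph :: "'a sgraph \<Rightarrow> 'a sgraph sgraph" where
  "realization_graph X =
     \<lparr>verts = realizations X,
      edges = {{G, H} | G H. G \<in> realizations X \<and> H \<in> realizations X \<and>
                 (\<exists>\<tau>\<in>switches G. H = apply_switch \<tau> G)}\<rparr>"

end

theory Submission imports Defs begin

text \<open>
  In a split graph with clique \<open>K\<close> and independent set \<open>I\<close>, write \<open>N u\<close> for the neighbours of
  \<open>u \<in> K\<close> in \<open>I\<close>.  A 2-switch exchanges some \<open>p \<in> N u - N v\<close> with some \<open>q \<in> N v - N u\<close>, so the
  2-switch-degree is the sum of \<open>card (N u - N v) * card (N v - N u)\<close> over the unordered pairs
  \<open>u, v\<close> in \<open>K\<close> (\<open>switch_deg_split_graph\<close>).

  Hence three clique vertices suffice.  Let \<open>N 0\<close> have \<open>k - 1\<close> elements, among them \<open>z\<close>, and let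
  \<open>N 1 = {w}\<close> with \<open>w \<notin> N 0\<close> and \<open>N 2 = {z}\<close>.  The pairs \<open>01\<close>, \<open>02\<close>, \<open>12\<close> contribute
  \<open>(k - 1) + 0 + 1 = k\<close>.  Exchanging \<open>z\<close> and \<open>w\<close> between the vertices \<open>0\<close> and \<open>1\<close> makes
  \<open>N 1 = N 2 = {z}\<close>, with \<open>z\<close> no longer in \<open>N 0\<close>, and the contributions become
  \<open>(k - 1) + (k - 1) + 0 = 2 * k - 2\<close>.

  The graph is prime because a 2-switch on a Tyshkevich composition never mixes vertices of the
  two factors (\<open>alternating_within_factor\<close>), while here every vertex takes part in a 2-switch
  together with \<open>w\<close>.  Finally, distinct 2-switches on \<open>G\<close> lead to distinct realizations, so the
  degree of \<open>G\<close> in its realization graph is its 2-switch-degree (\<open>degree_realization_graph\<close>);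
  regularity would thus force \<open>k = 2 * k - 2\<close>, which fails for \<open>k \<ge> 3\<close>.
\<close>

section \<open>Alternating 4-cycles\<close>

definition alternating :: "'a sgraph \<Rightarrow> 'a \<Rightarrow> 'a \<Rightarrow> 'a \<Rightarrow> 'a \<Rightarrow> bool" where
  "alternating G a b x y \<longleftrightarrow>
     a \<in> verts G \<and> b \<in> verts G \<and> x \<in> verts G \<and> y \<in> verts G \<and> distinct [a, b, x, y] \<and>
     {a, b} \<in> edges G \<and> {x, y} \<in> edges G \<and> {a, x} \<notin> edges G \<and> {b, y} \<notin> edges G"

lemma switches_alternating:
  "switches G = {({{a, b}, {x, y}}, {{a, x}, {b, y}}) | a b x y. alternating G a b x y}"
  unfolding switches_def alternating_def ..

lemma switch_cases:
  assumes "\<tau> \<in> switches G"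
  obtains a b x y where "alternating G a b x y" "\<tau> = ({{a, b}, {x, y}}, {{a, x}, {b, y}})"
  using assms unfolding switches_alternating by blast

lemma switch_deleted: "\<tau> \<in> switches G \<Longrightarrow> fst \<tau> \<subseteq> edges G"
  by (erule switch_cases) (simp add: alternating_def)

lemma switch_added: "\<tau> \<in> switches G \<Longrightarrow> snd \<tau> \<inter> edges G = {}"
  by (erule switch_cases) (simp add: alternating_def)

lemma finite_edges:
  assumes "simple_graph G"
  shows "finite (edges G)"
proof (rule finite_subset)
  show "edges G \<subseteq> Pow (verts G)" using assms by (auto simp: simple_graph_def)
  show "finite (Pow (verts G))" using assms by (simp add: simple_graph_def)
qed

section \<open>The realization graph\<close>

lemma simple_graph_apply_switch:
  assumes "simple_graph G" "\<tau> \<in> switches G"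
  shows "simple_graph (apply_switch \<tau> G)"
  using assms(2)
proof (cases rule: switch_cases)
  case (1 a b x y)
  then have "card {a, x} = 2" "card {b, y} = 2"
    by (auto simp: alternating_def)
  then show ?thesis
    using assms(1) 1 by (auto simp: alternating_def simple_graph_def apply_switch_def)
qed

text \<open>
  Each of the four vertices of a 2-switch lies on exactly one deleted and exactly one added edge.
\<close>

lemma degree_apply_switch:
  assumes "simple_graph G" "\<tau> \<in> switches G"
  shows "degree (apply_switch \<tau> G) v = degree G v"
proof -
  define X where "X = {e \<in> edges G. v \<in> e}"
  define D where "D = {e \<in> fst \<tau>. v \<in> e}"
  define A where "A = {e \<in> snd \<tau>. v \<in> e}"
  have sub: "D \<subseteq> X" using switch_deleted[OF assms(2)] by (auto simp: D_def X_def)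
  have disj: "A \<inter> X = {}" using switch_added[OF assms(2)] by (auto simp: A_def X_def)
  have fin: "finite X" using finite_edges[OF assms(1)] by (simp add: X_def)
  have "finite A \<and> card A = card D"
    using assms(2)
  proof (cases rule: switch_cases)
    case (1 a b x y)
    have dist: "distinct [a, b, x, y]" using 1(1) by (simp add: alternating_def)
    have D: "D = {e. (e = {a, b} \<or> e = {x, y}) \<and> v \<in> e}" using 1(2) by (auto simp: D_def)
    have A: "A = {e. (e = {a, x} \<or> e = {b, y}) \<and> v \<in> e}" using 1(2) by (auto simp: A_def)
    consider "v = a" | "v = b" | "v = x" | "v = y" | "v \<notin> {a, b, x, y}" by blast
    then show ?thesis
    proof cases
      assume "v = a"
      then have "D = {{a, b}}" "A = {{a, x}}" using D A dist by auto
      then show ?thesis by simp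
    next
      assume "v = b"
      then have "D = {{a, b}}" "A = {{b, y}}" using D A dist by auto
      then show ?thesis by simp
    next
      assume "v = x"
      then have "D = {{x, y}}" "A = {{a, x}}" using D A dist by auto
      then show ?thesis by simp
    next
      assume "v = y"
      then have "D = {{x, y}}" "A = {{b, y}}" using D A dist by auto
      then show ?thesis by simp
    next
      assume "v \<notin> {a, b, x, y}"
      then have "D = {}" "A = {}" using D A by auto
      then show ?thesis by simp
    qed
  qed
  then have "card ((X - D) \<union> A) = card X"
    using sub disj fin card_mono[OF fin sub] finite_subset[OF sub fin]
    by (subst card_Un_disjoint) (auto simp: card_Diff_subset)
  moreover have "{e \<in> edges (apply_switch \<tau> G). v \<in> e} = (X - D) \<union> A"
    by (auto simp: apply_switch_def X_def D_def A_def)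
  ultimately show ?thesis by (simp add: degree_def X_def)
qed

lemma apply_switch_realization:
  assumes "G \<in> realizations X" "\<tau> \<in> switches G"
  shows "apply_switch \<tau> G \<in> realizations X"
  using assms simple_graph_apply_switch[OF _ assms(2)] degree_apply_switch[OF _ assms(2)]
  by (simp add: realizations_def) (simp add: apply_switch_def)

text \<open>
  A 2-switch can be read off from its result: the deleted edges are all present before and the
  added ones all absent, so they are the two differences of the edge sets.
\<close>

lemma inj_apply_switch: "inj_on (\<lambda>\<tau>. apply_switch \<tau> G) (switches G)"
proof (rule inj_on_inverseI)
  fix \<tau> assume \<tau>: "\<tau> \<in> switches G"
  let ?E = "edges (apply_switch \<tau> G)"
  have "edges G - ?E = fst \<tau>" "?E - edges G = snd \<tau>"
    using switch_deleted[OF \<tau>] switch_added[OF \<tau>] by (auto simp: apply_switch_def)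
  then show "(\<lambda>H. (edges G - edges H, edges H - edges G)) (apply_switch \<tau> G) = \<tau>"
    by simp
qed

lemma switch_back:
  assumes "\<tau> \<in> switches G"
  shows "\<exists>\<sigma> \<in> switches (apply_switch \<tau> G). apply_switch \<sigma> (apply_switch \<tau> G) = G"
proof -
  obtain a b x y where alt: "alternating G a b x y"
    and \<tau>: "\<tau> = ({{a, b}, {x, y}}, {{a, x}, {b, y}})"
    using assms by (rule switch_cases)
  let ?\<sigma> = "({{a, x}, {b, y}}, {{a, b}, {x, y}})"
  have "alternating (apply_switch \<tau> G) a x b y"
    using alt by (auto simp: alternating_def apply_switch_def \<tau> doubleton_eq_iff)
  then have "?\<sigma> \<in> switches (apply_switch \<tau> G)"
    unfolding switches_alternating by blast
  moreover have "apply_switch ?\<sigma> (apply_switch \<tau> G) = G"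
    using alt by (auto simp: alternating_def apply_switch_def \<tau> intro!: sgraph.equality)
  ultimately show ?thesis by blast
qed

text \<open>
  Adjacency in the realization graph is symmetric by definition, but the neighbours of \<open>G\<close> are
  still only the graphs reached by a 2-switch from \<open>G\<close> itself, since a 2-switch leading to \<open>G\<close>
  can be reversed.
\<close>

lemma degree_realization_graph:
  assumes "G \<in> realizations X"
  shows "degree (realization_graph X) G = switch_deg G"
proof -
  let ?N = "(\<lambda>\<tau>. apply_switch \<tau> G) ` switches G"
  have "{e \<in> edges (realization_graph X). G \<in> e} = (\<lambda>H. {G, H}) ` ?N"
  proof (intro equalityI subsetI)
    fix e assume "e \<in> {e \<in> edges (realization_graph X). G \<in> e}"
    then obtain G' H' where "e = {G', H'}" "\<exists>\<tau>\<in>switches G'. H' = apply_switch \<tau> G'" "G \<in> e"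
      by (simp add: realization_graph_def) blast
    then obtain \<tau> where \<tau>: "\<tau> \<in> switches G'" and e: "e = {G', apply_switch \<tau> G'}"
      and "G = G' \<or> G = apply_switch \<tau> G'"
      by blast
    then have "\<exists>H \<in> ?N. e = {G, H}"
    proof (elim disjE)
      assume "G = G'"
      then show ?thesis using \<tau> e by blast
    next
      assume G: "G = apply_switch \<tau> G'"
      then have "G' \<in> ?N" using switch_back[OF \<tau>] by force
      moreover have "e = {G, G'}" using e G by (simp add: insert_commute)
      ultimately show ?thesis by blast
    qed
    then show "e \<in> (\<lambda>H. {G, H}) ` ?N" by (simp add: image_iff)
  next
    fix e assume "e \<in> (\<lambda>H. {G, H}) ` ?N"
    then obtain \<tau> where \<tau>: "\<tau> \<in> switches G" and e: "e = {G, apply_switch \<tau> G}" by blast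
    have "e \<in> edges (realization_graph X)"
      using assms \<tau> apply_switch_realization[OF assms \<tau>]
      unfolding realization_graph_def e by simp blast
    then show "e \<in> {e \<in> edges (realization_graph X). G \<in> e}" by (simp add: e)
  qed
  moreover have "inj_on (\<lambda>H. {G, H}) ?N"
    by (auto simp: inj_on_def doubleton_eq_iff)
  ultimately show ?thesis
    by (simp add: degree_def switch_deg_def card_image inj_apply_switch)
qed

section \<open>Switches and Tyshkevich composition\<close>

text \<open>
  A vertex of \<open>K\<close> is adjacent to all of \<open>K\<close> and of the second factor, so its non-neighbours lie in
  \<open>I\<close>; a vertex of \<open>I\<close> has its neighbours in \<open>K\<close>.  Walking along the alternating 4-cycle
  from \<open>a\<close> therefore alternates between \<open>K\<close> and \<open>I\<close> and never leaves the split factor.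
\<close>

lemma alternating_within_factor:
  assumes S: "split_graph S K I" and H: "simple_graph H" and disj: "verts S \<inter> verts H = {}"
    and alt: "alternating (tyshkevich_comp S K H) a b x y" and a: "a \<in> verts S"
  shows "{a, b, x, y} \<subseteq> verts S"
proof -
  let ?G = "tyshkevich_comp S K H"
  have S_edges: "e \<subseteq> verts S" if "e \<in> edges S" for e
    using S that by (auto simp: split_graph_def simple_graph_def)
  have H_edges: "e \<subseteq> verts H" if "e \<in> edges H" for e
    using H that by (auto simp: simple_graph_def)
  have KI: "verts S = K \<union> I" "K \<inter> I = {}"
    using S by (auto simp: split_graph_def)
  have from_K: "v \<in> I" if "u \<in> K" "v \<in> verts ?G" "u \<noteq> v" "{u, v} \<notin> edges ?G" for u v
    using that S by (auto simp: split_graph_def tyshkevich_comp_def)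
  have from_I: "v \<in> K" if "u \<in> I" "{u, v} \<in> edges ?G" for u v
  proof -
    have "{u, v} \<in> edges S"
      using that disj KI H_edges[of "{u, v}"]
      by (auto simp: tyshkevich_comp_def doubleton_eq_iff)
    then show ?thesis
      using S_edges[of "{u, v}"] S KI \<open>u \<in> I\<close> by (auto simp: split_graph_def)
  qed
  have *: "a \<noteq> x" "y \<noteq> b" "x \<in> verts ?G" "y \<in> verts ?G" "b \<in> verts ?G"
    "{a, b} \<in> edges ?G" "{x, y} \<in> edges ?G" "{a, x} \<notin> edges ?G" "{b, y} \<notin> edges ?G"
    "{y, b} \<notin> edges ?G" "{y, x} \<in> edges ?G"
    using alt by (auto simp: alternating_def insert_commute)
  show ?thesis
  proof (cases "a \<in> K")
    case True
    then have "x \<in> I" using from_K * by blast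
    then have "y \<in> K" using from_I * by blast
    then have "b \<in> I" using from_K * by blast
    then show ?thesis using True \<open>x \<in> I\<close> \<open>y \<in> K\<close> KI by blast
  next
    case False
    then have "a \<in> I" using a KI by blast
    then have "b \<in> K" using from_I * by blast
    then have "y \<in> I" using from_K[of b y] * by blast
    then have "x \<in> K" using from_I[of y x] * by blast
    then show ?thesis using \<open>a \<in> I\<close> \<open>b \<in> K\<close> \<open>y \<in> I\<close> KI by blast
  qed
qed

text \<open>
  The symmetries of the alternating 4-cycle act transitively on its vertices, so any of them may
  play the role of \<open>a\<close> in the previous lemma.
\<close>

lemma alternating_rotate:
  assumes "alternating G a b x y" "v \<in> {a, b, x, y}"
  obtains p q r where "alternating G v p q r" "{v, p, q, r} = {a, b, x, y}"
proof -
  have "alternating G b a y x" "alternating G x y a b" "alternating G y x b a"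
    using assms(1) by (auto simp: alternating_def insert_commute)
  then show ?thesis using assms that by blast
qed

text \<open>
  By the previous lemmas all vertices lie in the same factor of a composition as \<open>c\<close>, which leaves
  the other factor empty.
\<close>

lemma prime_if_switches_share_vertex:
  assumes G: "simple_graph G"
    and share: "\<And>v. v \<in> verts G \<Longrightarrow> \<exists>a b x y. alternating G a b x y \<and> {c, v} \<subseteq> {a, b, x, y}"
  shows "prime_graph G"
proof -
  have "active G"
    unfolding active_def active_vertex_def
  proof
    fix v assume "v \<in> verts G"
    then obtain a b x y where alt: "alternating G a b x y" and v: "v \<in> {a, b, x, y}"
      using share by (metis insert_subset)
    let ?\<tau> = "({{a, b}, {x, y}}, {{a, x}, {b, y}})"
    have "?\<tau> \<in> switches G" using alt unfolding switches_alternating by blast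
    moreover have "v \<in> \<Union> (fst ?\<tau> \<union> snd ?\<tau>)" using v by auto
    ultimately show "\<exists>\<tau>\<in>switches G. v \<in> \<Union> (fst \<tau> \<union> snd \<tau>)" by blast
  qed
  moreover have "\<not> decomposable G"
  proof
    assume "decomposable G"
    then obtain S K I H where S: "split_graph S K I" and H: "simple_graph H"
      and disj: "verts S \<inter> verts H = {}" and comp: "G = tyshkevich_comp S K H"
      unfolding decomposable_def by blast
    have verts: "verts G = verts S \<union> verts H" by (simp add: comp tyshkevich_comp_def)
    have step: "v \<in> verts S \<longleftrightarrow> c \<in> verts S" if v: "v \<in> verts G" for v
    proof -
      obtain a b x y where alt: "alternating G a b x y" and sub: "{c, v} \<subseteq> {a, b, x, y}"
        using share[OF v] by blast
      have "{a, b, x, y} \<subseteq> verts S" if u: "u \<in> {a, b, x, y}" "u \<in> verts S" for u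
      proof -
        obtain p q r where "alternating G u p q r" and eq: "{u, p, q, r} = {a, b, x, y}"
          using alt u(1) by (rule alternating_rotate)
        then have "{u, p, q, r} \<subseteq> verts S"
          using alternating_within_factor[OF S H disj _ u(2)] unfolding comp by blast
        then show ?thesis unfolding eq .
      qed
      from this[of v] this[of c] sub show ?thesis by auto
    qed
    have "verts S \<noteq> {}" "verts H \<noteq> {}"
      using S H by (auto simp: split_graph_def simple_graph_def)
    then show False using step verts disj by blast
  qed
  ultimately show ?thesis using G by (simp add: prime_graph_def)
qed

section \<open>Counting the switches of a split graph\<close>

definition outer_nbrs :: "'a sgraph \<Rightarrow> 'a set \<Rightarrow> 'a \<Rightarrow> 'a set" where
  "outer_nbrs G I u = {p \<in> I. {u, p} \<in> edges G}"

text \<open>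
  An alternating 4-cycle has exactly two vertices in \<open>K\<close>, opposite in the cycle, for the same
  reason as in the composition.  The 2-switch is symmetric in the pairs \<open>(u, p)\<close> and \<open>(v, q)\<close>;
  the order \<open>u < v\<close> selects one of the two descriptions, so that the parametrization becomes
  injective and can be used for counting.
\<close>

lemma switches_split_graph:
  fixes G :: "'a::linorder sgraph"
  assumes S: "split_graph G K I"
  defines "N \<equiv> outer_nbrs G I"
  shows "switches G = (\<lambda>((u, v), (p, q)). ({{u, p}, {v, q}}, {{u, q}, {v, p}})) `
    (SIGMA (u, v) : {(u, v) \<in> K \<times> K. u < v}. (N u - N v) \<times> (N v - N u))"
    (is "_ = ?f ` ?Q")
proof (intro equalityI subsetI)
  have KI: "verts G = K \<union> I" "K \<inter> I = {}"
    using S by (auto simp: split_graph_def)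
  have K: "{u, v} \<in> edges G" if "u \<in> K" "v \<in> K" "u \<noteq> v" for u v
    using S that by (auto simp: split_graph_def)
  have I: "{u, v} \<notin> edges G" if "u \<in> I" "v \<in> I" for u v
    using S that by (auto simp: split_graph_def)
  {
    fix \<tau> assume "\<tau> \<in> switches G"
    then obtain a b x y where alt: "alternating G a b x y"
      and \<tau>: "\<tau> = ({{a, b}, {x, y}}, {{a, x}, {b, y}})"
      by (rule switch_cases)
    have "\<exists>u v p q. u \<in> K \<and> v \<in> K \<and> u \<noteq> v \<and> p \<in> N u - N v \<and> q \<in> N v - N u \<and>
      \<tau> = ?f ((u, v), (p, q))"
    proof (cases "a \<in> K")
      case True
      then have "x \<in> I" using alt K KI by (auto simp: alternating_def)
      then have "y \<in> K" using alt I KI by (auto simp: alternating_def insert_commute)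
      then have "b \<in> I" using alt K KI by (auto simp: alternating_def)
      then have "b \<in> N a - N y" "x \<in> N y - N a" "a \<noteq> y"
        using \<open>x \<in> I\<close> alt
        by (simp_all add: alternating_def N_def outer_nbrs_def insert_commute)
      moreover have "\<tau> = ?f ((a, y), (b, x))"
        by (simp add: \<tau> insert_commute)
      ultimately show ?thesis using True \<open>y \<in> K\<close> by blast
    next
      case False
      then have "a \<in> I" using alt KI by (auto simp: alternating_def)
      then have "b \<in> K" using alt I KI by (auto simp: alternating_def insert_commute)
      then have "y \<in> I" using alt K KI by (auto simp: alternating_def)
      then have "x \<in> K" using alt I KI by (auto simp: alternating_def insert_commute)
      have "a \<in> N b - N x" "y \<in> N x - N b" "b \<noteq> x"
        using \<open>a \<in> I\<close> \<open>y \<in> I\<close> alt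
        by (simp_all add: alternating_def N_def outer_nbrs_def insert_commute)
      moreover have "\<tau> = ?f ((b, x), (a, y))"
        by (simp add: \<tau> insert_commute)
      ultimately show ?thesis using \<open>b \<in> K\<close> \<open>x \<in> K\<close> by blast
    qed
    then obtain u v p q where uv: "u \<in> K" "v \<in> K" "u \<noteq> v"
      and pq: "p \<in> N u - N v" "q \<in> N v - N u" and \<tau>': "\<tau> = ?f ((u, v), (p, q))"
      by blast
    consider "u < v" | "v < u" using uv(3) by (rule linorder_neqE)
    then show "\<tau> \<in> ?f ` ?Q"
    proof cases
      case 1
      then have "((u, v), (p, q)) \<in> ?Q" using uv pq by simp
      then show ?thesis unfolding \<tau>' by (rule imageI)
    next
      case 2
      then have "((v, u), (q, p)) \<in> ?Q" using uv pq by simp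
      moreover have "\<tau> = ?f ((v, u), (q, p))" using \<tau>' by (simp add: insert_commute)
      ultimately show ?thesis by (rule rev_image_eqI)
    qed
  next
    fix \<tau> assume "\<tau> \<in> ?f ` ?Q"
    then obtain u v p q where uv: "u \<in> K" "v \<in> K" "u < v"
      and pq: "p \<in> N u - N v" "q \<in> N v - N u"
      and \<tau>: "\<tau> = ({{u, p}, {q, v}}, {{u, q}, {p, v}})"
      by (auto simp: insert_commute)
    have "alternating G u p q v"
      using uv pq KI by (auto simp: alternating_def N_def outer_nbrs_def insert_commute)
    then show "\<tau> \<in> switches G"
      unfolding switches_alternating \<tau> by blast
  }
qed

lemma switch_deg_split_graph:
  fixes G :: "'a::linorder sgraph"
  assumes S: "split_graph G K I"
  defines "N \<equiv> outer_nbrs G I"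
  shows "switch_deg G =
    (\<Sum>(u, v) \<in> {(u, v) \<in> K \<times> K. u < v}. card (N u - N v) * card (N v - N u))"
proof -
  let ?P = "{(u, v) \<in> K \<times> K. u < v}"
  let ?Q = "SIGMA (u, v) : ?P. (N u - N v) \<times> (N v - N u)"
  let ?f = "\<lambda>((u, v), (p, q)). ({{u, p}, {v, q}}, {{u, q}, {v, p}})"
  have KI: "K \<inter> I = {}" and fin: "finite K" "finite I"
    using S by (auto simp: split_graph_def simple_graph_def)
  have N: "N u \<subseteq> I" for u by (auto simp: N_def outer_nbrs_def)
  have "inj_on ?f ?Q"
  proof (rule inj_onI)
    fix s t assume "s \<in> ?Q" "t \<in> ?Q" and eq: "?f s = ?f t"
    then obtain u v p q u' v' p' q' where st: "s = ((u, v), (p, q))" "t = ((u', v'), (p', q'))"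
      and mem: "u \<in> K" "v \<in> K" "u < v" "u' \<in> K" "v' \<in> K" "u' < v'"
        "p \<in> N u" "q \<in> N v" "p' \<in> N u'" "q' \<in> N v'"
      by auto
    have "p \<notin> K" "q \<notin> K" "p' \<notin> K" "q' \<notin> K" using mem N KI by blast+
    moreover have "{{u, p}, {v, q}} = {{u', p'}, {v', q'}}" using eq st by simp
    ultimately show "s = t"
      using mem by (auto simp: st doubleton_eq_iff)
  qed
  then have "switch_deg G = card ?Q"
    unfolding switch_deg_def switches_split_graph[OF S] N_def[symmetric] by (rule card_image)
  also have "\<dots> = (\<Sum>w\<in>?P. card (case w of (u, v) \<Rightarrow> (N u - N v) \<times> (N v - N u)))"
  proof (rule card_SigmaI)
    show "finite ?P" by (rule finite_subset[of _ "K \<times> K"]) (use fin in auto)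
    show "\<forall>w\<in>?P. finite (case w of (u, v) \<Rightarrow> (N u - N v) \<times> (N v - N u))"
      using finite_subset[OF N fin(2)] by auto
  qed
  also have "\<dots> = (\<Sum>(u, v)\<in>?P. card (N u - N v) * card (N v - N u))"
    by (rule sum.cong) (auto simp: card_cartesian_product)
  finally show ?thesis .
qed

corollary switch_deg_split_graph_3:
  assumes "split_graph G {0, 1, 2 :: nat} I"
  defines "N \<equiv> outer_nbrs G I"
  shows "switch_deg G = card (N 0 - N 1) * card (N 1 - N 0) +
    card (N 0 - N 2) * card (N 2 - N 0) + card (N 1 - N 2) * card (N 2 - N 1)"
proof -
  have "{(u, v) \<in> {0, 1, 2} \<times> {0, 1, 2 :: nat}. u < v} = {(0, 1), (0, 2), (1, 2)}"
    by auto
  then show ?thesis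
    using switch_deg_split_graph[OF assms(1)] by (simp add: N_def)
qed

section \<open>A triangle with pendants\<close>

text \<open>
  The vertices \<open>z\<close> and \<open>w\<close> of the introduction are \<open>3\<close> and \<open>4\<close>.
\<close>

definition triangle_with_pendants :: "nat \<Rightarrow> nat sgraph" where
  "triangle_with_pendants k = \<lparr>verts = {0, 1, 2} \<union> {3..<k + 3},
     edges = {{0, 1}, {0, 2}, {1, 2}} \<union> {{0, p} | p. p \<in> {3..<k + 3} - {4}} \<union> {{1, 4}, {2, 3}}\<rparr>"

definition unbalancing_switch :: "nat switch" where
  "unbalancing_switch = ({{0, 3}, {4, 1}}, {{0, 4}, {3, 1}})"

context
  fixes k :: nat
  assumes k: "k \<ge> 3"
begin

abbreviation "indep \<equiv> {3..<k + 3}"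
abbreviation "witness \<equiv> triangle_with_pendants k"
abbreviation "switched \<equiv> apply_switch unbalancing_switch witness"

lemma simple_witness: "simple_graph witness"
  using k by (auto simp: simple_graph_def triangle_with_pendants_def)

lemma alternating_witness:
  "p \<in> indep - {4} \<Longrightarrow> alternating witness 0 p 4 1" "alternating witness 2 3 4 1"
  using k by (auto simp: alternating_def triangle_with_pendants_def doubleton_eq_iff)

lemma prime_witness: "prime_graph witness"
proof (rule prime_if_switches_share_vertex[OF simple_witness, where c = 4])
  fix v assume "v \<in> verts witness"
  then consider "v \<in> indep - {4}" | "v \<in> {0, 1, 3, 4}" | "v = 2"
    by (auto simp: triangle_with_pendants_def)
  then show "\<exists>a b x y. alternating witness a b x y \<and> {4, v} \<subseteq> {a, b, x, y}"
  proof cases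
    case 1
    show ?thesis
      by (rule exI[of _ 0], rule exI[of _ v], rule exI[of _ 4], rule exI[of _ 1])
        (use alternating_witness(1)[OF 1] in simp)
  next
    case 2
    show ?thesis
      by (rule exI[of _ 0], rule exI[of _ 3], rule exI[of _ 4], rule exI[of _ 1])
        (use alternating_witness(1)[of 3] k 2 in auto)
  next
    case 3
    show ?thesis
      by (rule exI[of _ 2], rule exI[of _ 3], rule exI[of _ 4], rule exI[of _ 1])
        (use alternating_witness(2) 3 in simp)
  qed
qed

lemma unbalancing_switch: "unbalancing_switch \<in> switches witness"
proof -
  have "alternating witness 0 3 4 1" using alternating_witness(1)[of 3] k by simp
  then show ?thesis unfolding switches_alternating unbalancing_switch_def by blast
qed

lemma split_witness: "split_graph witness {0, 1, 2} indep"
  using simple_witness k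
  by (auto simp: split_graph_def triangle_with_pendants_def doubleton_eq_iff)

lemma split_switched: "split_graph switched {0, 1, 2} indep"
  using simple_graph_apply_switch[OF simple_witness unbalancing_switch] k
  by (auto simp: split_graph_def triangle_with_pendants_def apply_switch_def
      unbalancing_switch_def doubleton_eq_iff)

lemma outer_nbrs_witness:
  "outer_nbrs witness indep 0 = indep - {4}" "outer_nbrs witness indep 1 = {4}"
  "outer_nbrs witness indep 2 = {3}"
  using k by (auto simp: outer_nbrs_def triangle_with_pendants_def doubleton_eq_iff)

lemma outer_nbrs_switched:
  "outer_nbrs switched indep 0 = indep - {3}" "outer_nbrs switched indep 1 = {3}"
  "outer_nbrs switched indep 2 = {3}"
  using k by (auto simp: outer_nbrs_def triangle_with_pendants_def apply_switch_def
      unbalancing_switch_def doubleton_eq_iff)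

lemma switch_deg_witness: "switch_deg witness = k"
proof -
  have "indep - {4} - {4} = indep - {4}" "{4} - (indep - {4}) = {4}" "{3} - (indep - {4}) = {}"
    using k by auto
  then show ?thesis
    using switch_deg_split_graph_3[OF split_witness] k unfolding outer_nbrs_witness by simp
qed

lemma switch_deg_switched: "switch_deg switched = 2 * k - 2"
proof -
  have "indep - {3} - {3} = indep - {3}" "{3} - (indep - {3}) = {3}"
    using k by auto
  then show ?thesis
    using switch_deg_split_graph_3[OF split_switched] k unfolding outer_nbrs_switched by simp
qed

lemma realization_graph_not_regular: "\<not> regular (realization_graph witness)"
proof
  assume "regular (realization_graph witness)"
  then obtain d where d: "degree (realization_graph witness) H = d"
    if "H \<in> realizations witness" for H
    by (auto simp: regular_def realization_graph_def)
  have G: "witness \<in> realizations witness"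
    using simple_witness by (simp add: realizations_def)
  have G': "switched \<in> realizations witness"
    using apply_switch_realization[OF G unbalancing_switch] .
  have "k = 2 * k - 2"
    using d[OF G] d[OF G'] degree_realization_graph[OF G] degree_realization_graph[OF G']
    unfolding switch_deg_witness switch_deg_switched by metis
  then show False using k by simp
qed

end

theorem proposition7p4:
  fixes k :: nat
  assumes "k \<ge> 3"
  shows "\<exists>G :: nat sgraph.
           prime_graph G \<and> switch_deg G = k \<and>
           (\<exists>\<tau>\<in>switches G. switch_deg (apply_switch \<tau> G) = 2 * k - 2) \<and>
           \<not> regular (realization_graph G)"
  using prime_witness[OF assms] switch_deg_witness[OF assms] unbalancing_switch[OF assms]
    switch_deg_switched[OF assms] realization_graph_not_regular[OF assms]
  by blast

end
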